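(* Let $F_X$ and $F_Y$ be two cdfs such that there exists $d\in\mathbb{R}$ satisfying $F_Y(d)<1$ and $F_X(x)\geq F_Y(x)$ for every $x\geq d$. Let $\{X_n:n\in\mathbb{N}\}$ and $\{Y_n:n\in\mathbb{N}\}$ be two sequences of iid random variables with respective parent distribution functions $F_X$ and $F_Y$ and respective sequences of (upper) $k$th record values $\{R_n^{(k)}:n\in\mathbb{N}\}$ and $\{S_n^{(k)}:n\in\mathbb{N}\}$. Then $R_n^{(k)}\leq_{\mathrm{ast}} S_n^{(k)}$, as $n\to\infty$, for every $k\in\mathbb{N}$. Furthermore, $R_n^{(k)}\leq_{\mathrm{asp}} S_n^{(k)}$, as $n\to\infty$, for every $k\in\mathbb{N}$, if $F_X$ and $F_Y$ are independent (that is, the sequences $\{X_n\}$ and $\{Y_n\}$ are independent of each other).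
   Context: $X_{i:m}$ denotes the $i$th smallest among $X_1,\ldots,X_m$. For $k\in\mathbb{N}$, the upper $k$th record times are $T_1^{(k)}=1$ and $T_{n+1}^{(k)}=\min\{i\in\mathbb{N}: X_{i:i+k-1}>X_{T_n^{(k)}:T_n^{(k)}+k-1}\}$, and the upper $k$th record values are $R_n^{(k)}=X_{T_n^{(k)}:T_n^{(k)}+k-1}$. $S_n^{(k)}$ is defined likewise from $\{Y_n\}$. The cdfs of $R_n^{(k)}$ and $S_n^{(k)}$ are taken, following Dziubdziela and Kopociński, to be $\phi_{n,k}(F_X(x))$ and $\phi_{n,k}(F_Y(x))$ respectively, where $\phi_{n,k}(u)=\frac{1}{(n-1)!}\int_0^{-k\ln(1-u)}y^{n-1}e^{-y}\,dy$ for $u\in[0,1]$. For a cdf $F$, $F^{\leftarrow}(u)=\inf\{x\in\mathbb{R}: F(x)\ge u\}$ for $u\in(0,1)$; $\mu$ is Lebesgue measure. For sequences of random variables $U_n,V_n$ with cdfs $F_{U_n},F_{V_n}$: $U_n\leq_{\mathrm{ast}}V_n$, as $n\to\infty$, means $\lim_{n\to\infty}\mu(\{u\in(0,1): F_{U_n}^{\leftarrow}(u)>F_{V_n}^{\leftarrow}(u)\})=0$; $U_n\leq_{\mathrm{asp}}V_n$, as $n\to\infty$, means $\lim_{n\to\infty}P\{U_n\le V_n\}\ge 1/2$.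
   Formalization: In the asp claim the limit of P{R_n ≤ S_n}, which need not exist, is read as a limit inferior; claims are proved for the prescribed cdfs φ_{n,k}(F) with arbitrary F, and for the actual record values whenever their cdfs are those prescribed ones. *)

theory Defs
  imports "HOL-Probability.Probability"
begin

text \<open>Sequences are indexed by the positive naturals; the value at index 0 is never used.\<close>

definition order_stat :: "(nat \<Rightarrow> real) \<Rightarrow> nat \<Rightarrow> nat \<Rightarrow> real" where
  "order_stat x i m = sort (map x [1..<Suc m]) ! (i - 1)"

text \<open>The equation for index 0 is a dummy. If no further record occurs, \<open>LEAST\<close> yields an
  unspecified index.\<close>

fun record_time :: "nat \<Rightarrow> (nat \<Rightarrow> real) \<Rightarrow> nat \<Rightarrow> nat" where
  "record_time k x 0 = 1"
| "record_time k x (Suc 0) = 1"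
| "record_time k x (Suc (Suc n)) =
     (LEAST i. 1 \<le> i \<and>
        order_stat x i (i + k - 1) >
        order_stat x (record_time k x (Suc n)) (record_time k x (Suc n) + k - 1))"

definition record_value :: "nat \<Rightarrow> (nat \<Rightarrow> real) \<Rightarrow> nat \<Rightarrow> real" where
  "record_value k x n = order_stat x (record_time k x n) (record_time k x n + k - 1)"

definition record_rv :: "nat \<Rightarrow> (nat \<Rightarrow> 'a \<Rightarrow> real) \<Rightarrow> nat \<Rightarrow> 'a \<Rightarrow> real" where
  "record_rv k X n \<omega> = record_value k (\<lambda>i. X i \<omega>) n"

text \<open>The case distinction is needed because \<open>ln 0 = 0\<close> in the library, whereas the upper
  limit at \<open>u = 1\<close> is meant to be infinite.\<close>

definition record_phi :: "nat \<Rightarrow> nat \<Rightarrow> real \<Rightarrow> real" where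
  "record_phi n k u =
     1 / fact (n - 1) *
     (LBINT y=0..(if u = 1 then \<infinity> else ereal (- real k * ln (1 - u))). y ^ (n - 1) * exp (- y))"

definition rv_cdf :: "'a measure \<Rightarrow> ('a \<Rightarrow> real) \<Rightarrow> real \<Rightarrow> real" where
  "rv_cdf M U = cdf (distr M borel U)"

definition iid_with_cdf :: "'a measure \<Rightarrow> (nat \<Rightarrow> 'a \<Rightarrow> real) \<Rightarrow> (real \<Rightarrow> real) \<Rightarrow> bool" where
  "iid_with_cdf M X F \<longleftrightarrow>
     prob_space.indep_vars M (\<lambda>_. borel) X {1..} \<and> (\<forall>i\<ge>1. rv_cdf M (X i) = F)"

definition indep_seqs :: "'a measure \<Rightarrow> (nat \<Rightarrow> 'a \<Rightarrow> real) \<Rightarrow> (nat \<Rightarrow> 'a \<Rightarrow> real) \<Rightarrow> bool" where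
  "indep_seqs M X Y \<longleftrightarrow>
     prob_space.indep_var M
       (Pi\<^sub>M {1..} (\<lambda>_. borel)) (\<lambda>\<omega>. \<lambda>i\<in>{1..}. X i \<omega>)
       (Pi\<^sub>M {1..} (\<lambda>_. borel)) (\<lambda>\<omega>. \<lambda>i\<in>{1..}. Y i \<omega>)"

text \<open>For a continuous cdf this is the theorem of Dziubdziela and Kopocinski. If the cdf has atoms
  it can fail for record values defined by strict inequality.\<close>

definition has_record_cdfs ::
  "'a measure \<Rightarrow> nat \<Rightarrow> (nat \<Rightarrow> 'a \<Rightarrow> real) \<Rightarrow> (real \<Rightarrow> real) \<Rightarrow> bool" where
  "has_record_cdfs M k X F \<longleftrightarrow>
     (\<forall>n\<ge>1. \<forall>x. rv_cdf M (record_rv k X n) x = record_phi n k (F x))"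

definition quantile :: "(real \<Rightarrow> real) \<Rightarrow> real \<Rightarrow> real" where
  "quantile F u = Inf {x. F x \<ge> u}"

text \<open>The relation depends on the random variables only through their cdfs, hence it is
  defined for sequences of cdfs first.\<close>

definition ast_le_cdf :: "(nat \<Rightarrow> real \<Rightarrow> real) \<Rightarrow> (nat \<Rightarrow> real \<Rightarrow> real) \<Rightarrow> bool" where
  "ast_le_cdf F G \<longleftrightarrow>
     (\<lambda>n. measure lebesgue {u \<in> {0<..<1}. quantile (F n) u > quantile (G n) u})
       \<longlonglongrightarrow> 0"

definition ast_le :: "'a measure \<Rightarrow> (nat \<Rightarrow> 'a \<Rightarrow> real) \<Rightarrow> (nat \<Rightarrow> 'a \<Rightarrow> real) \<Rightarrow> bool" where
  "ast_le M U V \<longleftrightarrow> ast_le_cdf (\<lambda>n. rv_cdf M (U n)) (\<lambda>n. rv_cdf M (V n))"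

text \<open>The probabilities need not converge for record values: with \<open>Y\<close> standard exponential
  and \<open>- ln (1 - F\<^sub>X t)\<close> alternating, on long blocks, between \<open>t\<close> and \<open>t + t powr (3/4)\<close>,
  they oscillate between 1/2 and 1. The limit in the definition is therefore read as a limit
  inferior; the two agree whenever the limit exists.\<close>

definition asp_le :: "'a measure \<Rightarrow> (nat \<Rightarrow> 'a \<Rightarrow> real) \<Rightarrow> (nat \<Rightarrow> 'a \<Rightarrow> real) \<Rightarrow> bool" where
  "asp_le M U V \<longleftrightarrow>
     liminf (\<lambda>n. ereal (measure M {\<omega> \<in> space M. U n \<omega> \<le> V n \<omega>})) \<ge> ereal (1 / 2)"

text \<open>The same relation for independent random variables, given by their cdfs only; this is
  needed when the cdfs of the record values are prescribed.\<close>

definition asp_le_indep_cdf :: "(nat \<Rightarrow> real \<Rightarrow> real) \<Rightarrow> (nat \<Rightarrow> real \<Rightarrow> real) \<Rightarrow> bool" where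
  "asp_le_indep_cdf F G \<longleftrightarrow>
     liminf (\<lambda>n. ereal (measure (interval_measure (F n) \<Otimes>\<^sub>M interval_measure (G n))
                            {(x, y). x \<le> y})) \<ge> ereal (1 / 2)"

lemma asp_le_iff_limit:
  assumes "(\<lambda>n. measure M {\<omega> \<in> space M. U n \<omega> \<le> V n \<omega>}) \<longlonglongrightarrow> L"
  shows "asp_le M U V \<longleftrightarrow> L \<ge> 1 / 2"
proof -
  have "liminf (\<lambda>n. ereal (measure M {\<omega> \<in> space M. U n \<omega> \<le> V n \<omega>})) = ereal L"
    using assms by (intro lim_imp_Liminf) auto
  then show ?thesis by (simp add: asp_le_def)
qed

end

theory Submission imports Defs "HOL-Real_Asymp.Real_Asymp"
begin

text \<open>Write \<open>\<phi>\<^sub>n\<close> for \<open>record_phi n k\<close>, where \<open>n, k \<ge> 1\<close>. The argument rests on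
  two facts about \<open>\<phi>\<^sub>n\<close>, both read off from its identification with the Erlang distribution function of shape \<open>n\<close> evaluated at
  \<open>- k ln (1 - u)\<close>. It is a continuous increasing map of \<open>[0, 1]\<close> onto itself, so that
  \<open>\<phi>\<^sub>n \<circ> F\<close> is again a cdf and any inequality between \<open>F\<^sub>X\<close> and \<open>F\<^sub>Y\<close> carries over
  (\<open>real_distribution_record_phi\<close>, \<open>record_phi_mono\<close>). And \<open>\<phi>\<^sub>n u \<rightarrow> 0\<close> as \<open>n \<rightarrow> \<infinity>\<close> for every
  fixed \<open>u < 1\<close> (\<open>record_phi_tendsto_zero\<close>): a variable with cdf
  \<open>\<phi>\<^sub>n \<circ> F\<^sub>Y\<close> leaves the region up to \<open>d\<close>, below which the two parent cdfs may be in the wrong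
  order, with probability tending to 1.

  Hence it suffices to bound the failure of each order, for two cdfs with \<open>Q \<le> P\<close> on \<open>[d, \<infinity>)\<close>, by
  the mass \<open>Q d\<close>. For the quantile order, a level \<open>u > Q d\<close> is reached by \<open>Q\<close> only beyond \<open>d\<close>, where
  \<open>P\<close> has reached it already; so the bad levels lie in \<open>(0, Q d]\<close> (\<open>measure_quantile_greater_le\<close>).
  For the probability order, \<open>Q y \<le> P y + Q d\<close> holds for every \<open>y\<close>; integrating with respect to \<open>Q\<close>
  compares the probability of \<open>U \<le> V\<close>, for independent \<open>U\<close> and \<open>V\<close> with cdfs \<open>P\<close> and \<open>Q\<close>, with
  that of \<open>V' \<le> V\<close>, where \<open>V'\<close> is an independent copy of \<open>V\<close>, and the latter
  probability is at least 1/2 by symmetry (\<open>prob_le_ge_half_minus\<close>).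

  To pass from prescribed cdfs to the record values themselves, one needs that a record value is a
  measurable function of the sequence (\<open>measurable_record_value\<close>): independence of the
  sequences then gives independence of the record values, whose joint law is the product measure
  of the previous paragraph.\<close>

section \<open>The record value distribution function\<close>

definition record_bound :: "nat \<Rightarrow> real \<Rightarrow> ereal" where
  "record_bound k u = (if u = 1 then \<infinity> else ereal (- real k * ln (1 - u)))"

text \<open>The Erlang distribution with rate 1 and shape parameter \<open>m + 1\<close>: the density is proportional
  to \<open>x ^ m * exp (- x)\<close>.\<close>

abbreviation erlang_distr :: "nat \<Rightarrow> real measure" where
  "erlang_distr m \<equiv> density lborel (\<lambda>x. ennreal (erlang_density m 1 x))"

lemma record_bound_nonneg:
  assumes "u \<in> {0..1}" shows "0 \<le> record_bound k u"
proof (cases "u = 1")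
  case False
  then have "ln (1 - u) \<le> 0" using assms by (subst ln_le_zero_iff) auto
  then show ?thesis using False
    by (simp add: record_bound_def mult_nonneg_nonpos)
qed (simp add: record_bound_def)

lemma record_bound_mono:
  assumes "0 \<le> u" "u \<le> v" "v \<le> 1" shows "record_bound k u \<le> record_bound k v"
proof (cases "v = 1")
  case False
  then have "ln (1 - v) \<le> ln (1 - u)" using assms by (subst ln_le_cancel_iff) auto
  then show ?thesis using False assms
    by (auto simp: record_bound_def intro!: mult_left_mono)
qed (simp add: record_bound_def)

text \<open>Monotonicity and the value at 1 are easiest for the probability of an interval, and this form
  covers finite and infinite upper limits uniformly.\<close>

lemma record_phi_eq_measure:
  assumes "u \<in> {0..1}"
  shows "record_phi n k u = measure (erlang_distr (n - 1)) (einterval 0 (record_bound k u))"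
proof -
  define I where "I = einterval 0 (record_bound k u)"
  have [measurable]: "I \<in> sets borel" by (simp add: I_def)
  have pos: "0 < x" if "x \<in> I" for x using that by (simp add: I_def einterval_def)
  have "record_phi n k u =
      (\<integral>y. indicator I y * (y ^ (n - 1) * exp (- y) / fact (n - 1)) \<partial>lborel)"
    using record_bound_nonneg[OF assms, of k]
    unfolding record_phi_def record_bound_def[symmetric] interval_lebesgue_integral_def I_def[symmetric]
      set_lebesgue_integral_def
    by (simp flip: I_def Bochner_Integration.integral_mult_right_zero
          Bochner_Integration.integral_divide_zero add: field_simps)
  also have "\<dots> = (\<integral>y. indicator I y * erlang_density (n - 1) 1 y \<partial>lborel)"
    using pos by (intro Bochner_Integration.integral_cong)
      (auto simp: erlang_density_def indicator_def dest: pos)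
  also have "\<dots> = enn2real (\<integral>\<^sup>+y. ennreal (indicator I y * erlang_density (n - 1) 1 y) \<partial>lborel)"
    by (intro integral_eq_nn_integral) auto
  also have "\<dots> = measure (erlang_distr (n - 1)) I"
    by (simp add: measure_def emeasure_density mult.commute ennreal_mult' ennreal_indicator)
  finally show ?thesis by (simp add: I_def)
qed

lemma record_phi_mono:
  assumes "0 \<le> u" "u \<le> v" "v \<le> 1" shows "record_phi n k u \<le> record_phi n k v"
proof -
  interpret prob_space "erlang_distr (n - 1)" by (rule prob_space_erlang_density) simp
  have "einterval 0 (record_bound k u) \<subseteq> einterval 0 (record_bound k v)"
    using record_bound_mono[OF assms, of k] by (auto simp: einterval_def)
  then have "prob (einterval 0 (record_bound k u)) \<le> prob (einterval 0 (record_bound k v))"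
    by (intro finite_measure_mono) auto
  then show ?thesis using assms by (simp add: record_phi_eq_measure)
qed

lemma record_phi_one: "record_phi n k 1 = 1"
proof -
  interpret prob_space "erlang_distr (n - 1)" by (rule prob_space_erlang_density) simp
  have "AE x in erlang_distr (n - 1). x \<in> einterval 0 \<infinity>"
    unfolding zero_ereal_def einterval_eq
    using AE_lborel_singleton[of "0::real"]
    by (auto simp: AE_density erlang_density_def elim!: eventually_mono)
  then have "prob (einterval 0 \<infinity>) = 1"
    by (subst prob_eq_1) auto
  then show ?thesis
    by (subst record_phi_eq_measure) (auto simp: record_bound_def)
qed

text \<open>The closed form, the Poisson tail with mean \<open>- k ln (1 - u)\<close>, gives the continuity in \<open>u\<close> and
  the limit in \<open>n\<close>.\<close>

lemma record_phi_less_one: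
  assumes "0 \<le> u" "u < 1"
  shows "record_phi n k u =
    1 - (\<Sum>i\<le>n - 1. (- real k * ln (1 - u)) ^ i * exp (real k * ln (1 - u)) / fact i)"
proof -
  define t where "t = - real k * ln (1 - u)"
  have t: "record_bound k u = ereal t" "0 \<le> t"
    using assms record_bound_nonneg[of u k] by (auto simp: record_bound_def t_def)
  have "measure (erlang_distr (n - 1)) {0<..<t} = measure (erlang_distr (n - 1)) {..t}"
  proof (rule measure_eq_AE)
    show "AE x in erlang_distr (n - 1). (x \<in> {0<..<t}) = (x \<in> {..t})"
      using AE_lborel_singleton[of 0] AE_lborel_singleton[of t]
      by (simp add: AE_density, eventually_elim) (auto simp: erlang_density_def)
  qed auto
  also have "\<dots> = erlang_CDF (n - 1) 1 t"
    by (simp add: measure_def emeasure_erlang_density)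
  finally show ?thesis
    using assms t by (simp add: record_phi_eq_measure erlang_CDF_def zero_ereal_def t_def)
qed

lemma record_phi_zero: "record_phi n k 0 = 0"
  by (subst record_phi_eq_measure) (auto simp: record_bound_def zero_ereal_def)

text \<open>Below 1 the closed form is visibly continuous. At 1 it breaks down, and
  \<open>t ^ i * exp (- t) \<rightarrow> 0\<close> as \<open>t \<rightarrow> \<infinity>\<close> shows that it approaches the value 1. Left continuity
  at 1 matters because a cdf may approach 1 without attaining it.\<close>

lemma record_phi_continuous:
  assumes "k \<ge> 1" shows "continuous_on {0..1} (record_phi n k)"
proof -
  define g where "g = (\<lambda>u. 1 - (\<Sum>i\<le>n - 1. (- real k * ln (1 - u)) ^ i * exp (real k * ln (1 - u)) / fact i))"
  have "continuous (at u within {0..1}) (record_phi n k)" if u: "u \<in> {0..1}" for u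
  proof (cases "u = 1")
    case False
    with u have u: "0 \<le> u" "u < 1" by auto
    have "isCont g u" unfolding g_def using u by (intro continuous_intros) auto
    then have "(g \<longlongrightarrow> g u) (at u within {0..1})"
      by (simp add: continuous_at_imp_continuous_at_within flip: continuous_within)
    moreover have "eventually (\<lambda>v. v \<in> {..<1}) (nhds u)"
      by (rule eventually_nhds_in_open) (use u in auto)
    then have "eventually (\<lambda>v. g v = record_phi n k v) (at u within {0..1})"
      by (auto simp: eventually_at_filter record_phi_less_one g_def elim!: eventually_mono)
    ultimately have "(record_phi n k \<longlongrightarrow> g u) (at u within {0..1})"
      by (rule Lim_transform_eventually)
    moreover have "g u = record_phi n k u" using u by (simp add: g_def record_phi_less_one)
    ultimately show ?thesis
      unfolding continuous_within by simp
  next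
    case True
    have t: "filterlim (\<lambda>v. - real k * ln (1 - v)) at_top (at_left 1)"
    proof -
      have "real k > 0" using assms by simp
      then show ?thesis by real_asymp
    qed
    have "((\<lambda>v. 1 - (\<Sum>i\<le>n - 1. (- real k * ln (1 - v)) ^ i / exp (- real k * ln (1 - v)) / fact i))
       \<longlongrightarrow> 1 - (\<Sum>i\<le>n - 1. 0 / fact i)) (at_left 1)"
      by (intro tendsto_intros filterlim_compose[OF tendsto_power_div_exp_0 t]) auto
    then have "(g \<longlongrightarrow> 1) (at_left 1)"
      by (simp add: g_def exp_minus field_simps)
    then have "(g \<longlongrightarrow> 1) (at 1 within {0..1})"
      by (simp add: at_within_Icc_at_left)
    moreover have "eventually (\<lambda>v. g v = record_phi n k v) (at 1 within {0..1})"
      by (auto simp: eventually_at_filter g_def record_phi_less_one)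
    ultimately show ?thesis
      unfolding continuous_within True record_phi_one by (rule Lim_transform_eventually)
  qed
  then show ?thesis by (simp add: continuous_on_eq_continuous_within)
qed

text \<open>In the closed form the partial sums of the series of \<open>exp t\<close> are multiplied by \<open>exp (- t)\<close>,
  and so tend to 1.\<close>

lemma record_phi_tendsto_zero:
  assumes "0 \<le> u" "u < 1" shows "(\<lambda>n. record_phi n k u) \<longlonglongrightarrow> 0"
proof -
  define t where "t = - real k * ln (1 - u)"
  have "(\<lambda>n. 1 - (\<Sum>i\<le>n. t ^ i /\<^sub>R fact i) * exp (- t)) \<longlonglongrightarrow> 1 - exp t * exp (- t)"
    using exp_converges[of t] by (intro tendsto_intros) (simp add: sums_def_le)
  moreover have "record_phi (Suc n) k u = 1 - (\<Sum>i\<le>n. t ^ i /\<^sub>R fact i) * exp (- t)" for n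
    by (simp add: record_phi_less_one[OF assms] t_def sum_distrib_left sum_distrib_right divide_inverse mult_ac)
  ultimately have "(\<lambda>n. record_phi (Suc n) k u) \<longlonglongrightarrow> 0"
    by (simp flip: exp_add)
  then show ?thesis by (rule LIMSEQ_imp_Suc)
qed

lemma real_distribution_record_phi:
  fixes n k :: nat
  assumes "real_distribution P" "k \<ge> 1"
  defines "F \<equiv> \<lambda>x. record_phi n k (cdf P x)"
  shows "real_distribution (interval_measure F)" "cdf (interval_measure F) = F"
proof -
  interpret real_distribution P by fact
  have rng: "cdf P x \<in> {0..1}" for x by (simp add: cdf_nonneg cdf_bounded_prob)
  note cont = continuous_on_tendsto_compose[OF record_phi_continuous[OF \<open>k \<ge> 1\<close>, of n]]
  have mono: "F x \<le> F y" if "x \<le> y" for x y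
    unfolding F_def using that by (intro record_phi_mono cdf_nondecreasing cdf_nonneg cdf_bounded_prob)
  have right: "continuous (at_right a) F" for a
    using cdf_is_right_cont[of a] unfolding F_def continuous_within
    by (intro cont) (use rng in auto)
  have bot: "(F \<longlongrightarrow> 0) at_bot"
    using cont[OF cdf_lim_at_bot] rng by (simp add: F_def record_phi_zero)
  have top: "(F \<longlongrightarrow> 1) at_top"
    using cont[OF cdf_lim_at_top_prob] rng by (simp add: F_def record_phi_one)
  show "real_distribution (interval_measure F)" "cdf (interval_measure F) = F"
    using mono right bot top by (auto intro!: real_distribution_interval_measure cdf_interval_measure)
qed

section \<open>Comparison of two cdfs that are ordered beyond a point\<close>

text \<open>A level above \<open>cdf Q d\<close> is reached by \<open>cdf Q\<close> only at points where \<open>cdf P\<close> is at least as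
  large. The limits of the cdfs at both ends make the infima genuine ones.\<close>

lemma quantile_le_if_cdf_ge_beyond:
  assumes "real_distribution P" "real_distribution Q"
    and "\<And>x. x \<ge> d \<Longrightarrow> cdf Q x \<le> cdf P x" and "cdf Q d < u" "u < 1"
  shows "quantile (cdf P) u \<le> quantile (cdf Q) u"
proof -
  interpret P: real_distribution P by fact
  interpret Q: real_distribution Q by fact
  have "eventually (\<lambda>x. u < cdf Q x) at_top"
    using Q.cdf_lim_at_top_prob \<open>u < 1\<close> by (rule order_tendstoD)
  then obtain x where "u < cdf Q x" by (auto simp: eventually_at_top_linorder)
  then have ne: "{x. u \<le> cdf Q x} \<noteq> {}" by (auto intro: less_imp_le)
  have "0 < u" using \<open>cdf Q d < u\<close> Q.cdf_nonneg[of d] by linarith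
  with P.cdf_lim_at_bot have "eventually (\<lambda>x. cdf P x < u) at_bot"
    by (rule order_tendstoD)
  then obtain b where b: "\<And>x. x \<le> b \<Longrightarrow> cdf P x < u" by (auto simp: eventually_at_bot_linorder)
  have "bdd_below {x. u \<le> cdf P x}"
    by (rule bdd_belowI[of _ b]) (metis b linorder_le_cases linorder_not_less mem_Collect_eq)
  moreover have "{x. u \<le> cdf Q x} \<subseteq> {x. u \<le> cdf P x}"
  proof safe
    fix x assume "u \<le> cdf Q x"
    moreover have "d \<le> x"
      using Q.cdf_nondecreasing[of x d] \<open>cdf Q d < u\<close> calculation by linarith
    ultimately show "u \<le> cdf P x" using assms(3)[of x] by linarith
  qed
  ultimately show ?thesis
    unfolding quantile_def using ne by (intro cInf_superset_mono)
qed

lemma measure_quantile_greater_le: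
  assumes "real_distribution P" "real_distribution Q"
    and "\<And>x. x \<ge> d \<Longrightarrow> cdf Q x \<le> cdf P x"
  shows "measure lebesgue {u \<in> {0<..<1}. quantile (cdf P) u > quantile (cdf Q) u} \<le> cdf Q d"
proof -
  interpret Q: real_distribution Q by fact
  define B where "B = {u \<in> {0<..<1}. quantile (cdf P) u > quantile (cdf Q) u}"
  have "B \<subseteq> {0..cdf Q d}"
    using quantile_le_if_cdf_ge_beyond[OF assms] unfolding B_def by force
  \<comment> \<open>A non-measurable set has measure 0 by convention, so the bound holds for it too.\<close>
  then have "measure lebesgue B \<le> measure lebesgue {0..cdf Q d}"
    by (cases "B \<in> sets lebesgue") (rule measure_mono_fmeasurable, simp_all, simp add: measure_notin_sets)
  also have "\<dots> = cdf Q d" by (simp add: Q.cdf_nonneg)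
  finally show ?thesis by (simp add: B_def)
qed

lemma measurable_le_set [measurable]:
  "{(x, y). x \<le> y} \<in> sets (borel \<Otimes>\<^sub>M (borel :: real measure))"
proof -
  have "{p \<in> space (borel \<Otimes>\<^sub>M (borel :: real measure)). fst p \<le> snd p} \<in> sets (borel \<Otimes>\<^sub>M borel)"
    by measurable
  then show ?thesis by (simp add: space_pair_measure case_prod_unfold)
qed

text \<open>For two independent copies \<open>V'\<close> and \<open>V\<close>, the events \<open>V' \<le> V\<close> and \<open>V \<le> V'\<close> are equally likely
  and cover everything.\<close>

lemma (in real_distribution) half_le_prob_le:
  "1 / 2 \<le> measure (M \<Otimes>\<^sub>M M) {(x, y). x \<le> y}"
proof -
  interpret pair_prob_space M M ..
  let ?A = "{(x, y). x \<le> y} :: (real \<times> real) set" and ?B = "{(x, y). y \<le> x} :: (real \<times> real) set"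
  have sets: "sets (M \<Otimes>\<^sub>M M) = sets (borel \<Otimes>\<^sub>M borel)" by (intro sets_pair_measure_cong) auto
  have A: "?A \<in> sets (M \<Otimes>\<^sub>M M)" using measurable_le_set sets by simp
  have "{p \<in> space (borel \<Otimes>\<^sub>M (borel :: real measure)). snd p \<le> fst p} \<in> sets (borel \<Otimes>\<^sub>M borel)"
    by measurable
  then have B: "?B \<in> sets (M \<Otimes>\<^sub>M M)" by (simp add: space_pair_measure case_prod_unfold sets)
  have "measure (M \<Otimes>\<^sub>M M) ?A = measure (distr (M \<Otimes>\<^sub>M M) (M \<Otimes>\<^sub>M M) (\<lambda>(x, y). (y, x))) ?A"
    using distr_pair_swap by simp
  also have "\<dots> = measure (M \<Otimes>\<^sub>M M) ?B"
    using A by (subst measure_distr) (auto intro!: arg_cong2[where f=measure] simp: space_pair_measure)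
  finally have eq: "measure (M \<Otimes>\<^sub>M M) ?A = measure (M \<Otimes>\<^sub>M M) ?B" .
  have "1 = measure (M \<Otimes>\<^sub>M M) (?A \<union> ?B)"
  proof -
    have "?A \<union> ?B = space (M \<Otimes>\<^sub>M M)" by (auto simp: space_pair_measure)
    then show ?thesis using P.prob_space by simp
  qed
  also have "\<dots> \<le> measure (M \<Otimes>\<^sub>M M) ?A + measure (M \<Otimes>\<^sub>M M) ?B"
    using A B by (rule measure_Un_le)
  finally show ?thesis using eq by simp
qed

lemma prob_le_eq_nn_integral_cdf:
  assumes "real_distribution P" "real_distribution Q"
  shows "emeasure (P \<Otimes>\<^sub>M Q) {(x, y). x \<le> y} = (\<integral>\<^sup>+y. ennreal (cdf P y) \<partial>Q)"
proof -
  interpret P: real_distribution P by fact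
  interpret Q: real_distribution Q by fact
  interpret PQ: pair_prob_space P Q ..
  have "sets (P \<Otimes>\<^sub>M Q) = sets (borel \<Otimes>\<^sub>M borel)" by (intro sets_pair_measure_cong) auto
  then have A: "{(x, y). x \<le> y} \<in> sets (P \<Otimes>\<^sub>M Q)" using measurable_le_set by simp
  have "(\<lambda>x. (x, y)) -` {(x, y). x \<le> y} = {..y}" for y :: real by auto
  then show ?thesis
    by (simp add: PQ.emeasure_pair_measure_alt2[OF A] cdf_def P.emeasure_eq_measure)
qed

text \<open>Conditioning on the second coordinate turns the probability into \<open>\<integral> cdf P \<partial>Q\<close>. Replacing
  \<open>cdf P\<close> by \<open>cdf Q\<close> costs at most \<open>cdf Q d\<close>, whether the point lies below or above \<open>d\<close>, and yields
  the probability of the symmetric case.\<close>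

lemma prob_le_ge_half_minus:
  assumes "real_distribution P" "real_distribution Q"
    and "\<And>x. x \<ge> d \<Longrightarrow> cdf Q x \<le> cdf P x"
  shows "1 / 2 - cdf Q d \<le> measure (P \<Otimes>\<^sub>M Q) {(x, y). x \<le> y}"
proof -
  interpret P: real_distribution P by fact
  interpret Q: real_distribution Q by fact
  interpret PQ: pair_prob_space P Q ..
  interpret QQ: pair_prob_space Q Q ..
  have le: "cdf Q y \<le> cdf P y + cdf Q d" for y
    using assms(3)[of y] Q.cdf_nondecreasing[of y d] P.cdf_nonneg[of y] Q.cdf_nonneg[of d]
    by (cases "d \<le> y") linarith+
  have meas: "cdf P \<in> borel_measurable Q"
    by (intro Q.measurable_finite_borel borel_measurable_mono monoI P.cdf_nondecreasing)
  have "emeasure (Q \<Otimes>\<^sub>M Q) {(x, y). x \<le> y} = (\<integral>\<^sup>+y. ennreal (cdf Q y) \<partial>Q)"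
    by (rule prob_le_eq_nn_integral_cdf) fact+
  also have "\<dots> \<le> (\<integral>\<^sup>+y. ennreal (cdf P y) + ennreal (cdf Q d) \<partial>Q)"
    by (intro nn_integral_mono) (simp add: le P.cdf_nonneg Q.cdf_nonneg flip: ennreal_plus)
  also have "\<dots> = emeasure (P \<Otimes>\<^sub>M Q) {(x, y). x \<le> y} + ennreal (cdf Q d)"
    using meas Q.emeasure_space_1
    by (simp add: nn_integral_add prob_le_eq_nn_integral_cdf[OF assms(1,2)])
  finally have "measure (Q \<Otimes>\<^sub>M Q) {(x, y). x \<le> y} \<le> measure (P \<Otimes>\<^sub>M Q) {(x, y). x \<le> y} + cdf Q d"
    by (simp add: PQ.P.emeasure_eq_measure QQ.P.emeasure_eq_measure Q.cdf_nonneg flip: ennreal_plus)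
  with Q.half_le_prob_le show ?thesis by linarith
qed

lemma half_le_liminf:
  fixes p e :: "nat \<Rightarrow> real"
  assumes "e \<longlonglongrightarrow> 0" and "eventually (\<lambda>n. 1 / 2 - e n \<le> p n) sequentially"
  shows "ereal (1 / 2) \<le> liminf (\<lambda>n. ereal (p n))"
proof -
  have "(\<lambda>n. ereal (1 / 2 - e n)) \<longlonglongrightarrow> ereal (1 / 2 - 0)"
    using assms(1) by (intro tendsto_intros)
  then have "liminf (\<lambda>n. ereal (1 / 2 - e n)) = ereal (1 / 2)"
    by (intro lim_imp_Liminf) auto
  moreover have "liminf (\<lambda>n. ereal (1 / 2 - e n)) \<le> liminf (\<lambda>n. ereal (p n))"
    using assms(2) by (intro Liminf_mono) (simp add: eventually_mono)
  ultimately show ?thesis by simp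
qed

section \<open>Measurability of record values\<close>

text \<open>An order statistic is at most a given level exactly if enough entries are. The number
  of such entries is a finite sum of indicators, which makes measurability plain.\<close>

lemma sorted_nth_le_iff:
  fixes a :: "'b :: linorder"
  assumes "sorted ys" "j < length ys"
  shows "ys ! j \<le> a \<longleftrightarrow> j < length (filter (\<lambda>y. y \<le> a) ys)"
  using assms
proof (induction ys arbitrary: j)
  case (Cons y ys)
  show ?case
  proof (cases "y \<le> a")
    case True
    then show ?thesis using Cons by (cases j) auto
  next
    case False
    then have "\<forall>z\<in>set (y # ys). \<not> z \<le> a" using Cons.prems(1) by auto
    moreover have "(y # ys) ! j \<in> set (y # ys)" using Cons.prems(2) by (rule nth_mem)
    ultimately show ?thesis by (metis filter_False length_0_conv not_less_zero)
  qed
qed simp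

lemma sort_nth_le_iff:
  fixes a :: "'b :: linorder"
  assumes "j < length xs"
  shows "sort xs ! j \<le> a \<longleftrightarrow> j < length (filter (\<lambda>y. y \<le> a) xs)"
proof -
  have "length (filter (\<lambda>y. y \<le> a) (sort xs)) = length (filter (\<lambda>y. y \<le> a) xs)"
    by (simp add: filter_sort)
  then show ?thesis using sorted_nth_le_iff[of "sort xs" j a] assms by simp
qed

lemma borel_measurable_order_stat [measurable]:
  "(\<lambda>x. order_stat x i m) \<in> borel_measurable (Pi\<^sub>M {1..} (\<lambda>_. borel))"
proof (cases "i - 1 < m")
  case True
  have "length (filter (\<lambda>y. y \<le> a) (map x [1..<Suc m])) = (\<Sum>j\<in>{1..m}. if x j \<le> a then 1 else 0)"
    for a and x :: "nat \<Rightarrow> real"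
    by (induction m) auto
  then have eq: "order_stat x i m \<le> a \<longleftrightarrow> i - 1 < (\<Sum>j\<in>{1..m}. if x j \<le> a then 1 else 0)" for a x
    unfolding order_stat_def using True by (subst sort_nth_le_iff) simp_all
  show ?thesis
    unfolding borel_measurable_iff_le eq by measurable
next
  case False
  \<comment> \<open>An index past the end gives an unspecified value, but one that does not depend on \<open>x\<close>.\<close>
  have "sort (map x [1..<Suc m]) ! (i - 1) = [] ! (i - 1 - m)" for x :: "nat \<Rightarrow> real"
    using False nth_append_right[of "sort (map x [1..<Suc m])" "i - 1" "[]"] by (simp del: upt_Suc)
  then show ?thesis by (simp add: order_stat_def)
qed

text \<open>A record value is an order statistic at a random index. The index is integer-valued, so
  measurability survives the composition, and each record time is the least integer at which
  a comparison with the preceding record value holds; the two claims therefore go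
  together by induction.\<close>

lemma measurable_record_time_value:
  shows measurable_record_time:
      "(\<lambda>x. record_time k x n) \<in> measurable (Pi\<^sub>M {1..} (\<lambda>_. borel)) (count_space UNIV)"
    and measurable_record_value:
      "(\<lambda>x. record_value k x n) \<in> borel_measurable (Pi\<^sub>M {1..} (\<lambda>_. borel))"
proof -
  have rec: "(\<lambda>x. record_value k x n) \<in> borel_measurable (Pi\<^sub>M {1..} (\<lambda>_. borel))"
    if "(\<lambda>x. record_time k x n) \<in> measurable (Pi\<^sub>M {1..} (\<lambda>_. borel)) (count_space UNIV)" for n
    unfolding record_value_def
    by (rule measurable_compose_countable[OF borel_measurable_order_stat that])
  show time: "(\<lambda>x. record_time k x n) \<in> measurable (Pi\<^sub>M {1..} (\<lambda>_. borel)) (count_space UNIV)" for n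
  proof (induction n rule: induct_nat_012)
    case (ge2 n)
    note [measurable] = rec[OF ge2(2)]
    show ?case
      unfolding record_time.simps record_value_def[symmetric] by measurable
  qed simp_all
  show "(\<lambda>x. record_value k x n) \<in> borel_measurable (Pi\<^sub>M {1..} (\<lambda>_. borel))"
    by (rule rec[OF time])
qed

text \<open>The independence hypothesis concerns the sequences restricted to the positive indices. The
  following lemmas show that record values are functions of these restrictions.\<close>

lemma order_stat_restrict: "order_stat (restrict x {1..}) i m = order_stat x i m"
proof -
  have "map (restrict x {1..}) [1..<Suc m] = map x [1..<Suc m]" by (rule map_cong) auto
  then show ?thesis by (simp only: order_stat_def)
qed

lemma record_time_restrict: "record_time k (restrict x {1..}) n = record_time k x n"
  by (induction n rule: induct_nat_012) (simp_all only: record_time.simps order_stat_restrict)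

lemma record_value_restrict: "record_value k (restrict x {1..}) n = record_value k x n"
  by (simp only: record_value_def record_time_restrict order_stat_restrict)

lemma record_rv_eq_comp:
  "record_rv k X n = (\<lambda>x. record_value k x n) \<circ> (\<lambda>\<omega>. \<lambda>i\<in>{1..}. X i \<omega>)"
  by (rule ext) (simp only: record_rv_def record_value_restrict comp_def)

section \<open>The asymptotic comparison of record values\<close>

theorem theorem7p10:
  fixes M :: "'a measure" and X Y :: "nat \<Rightarrow> 'a \<Rightarrow> real"
    and F\<^sub>X F\<^sub>Y :: "real \<Rightarrow> real" and d :: real
  assumes "prob_space M"
    and "iid_with_cdf M X F\<^sub>X"
    and "iid_with_cdf M Y F\<^sub>Y"
    and "F\<^sub>Y d < 1"
    and "\<And>x. x \<ge> d \<Longrightarrow> F\<^sub>X x \<ge> F\<^sub>Y x"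
  shows "\<forall>k\<ge>1.
    ast_le_cdf (\<lambda>n x. record_phi n k (F\<^sub>X x)) (\<lambda>n x. record_phi n k (F\<^sub>Y x)) \<and>
    asp_le_indep_cdf (\<lambda>n x. record_phi n k (F\<^sub>X x)) (\<lambda>n x. record_phi n k (F\<^sub>Y x)) \<and>
    (has_record_cdfs M k X F\<^sub>X \<and> has_record_cdfs M k Y F\<^sub>Y \<longrightarrow>
       ast_le M (record_rv k X) (record_rv k Y) \<and>
       (indep_seqs M X Y \<longrightarrow> asp_le M (record_rv k X) (record_rv k Y)))"
proof (intro allI impI)
  fix k :: nat assume k: "1 \<le> k"
  interpret prob_space M by fact
  define P Q where "P = distr M borel (X 1)" and "Q = distr M borel (Y 1)"
  have "random_variable borel (X 1)" "random_variable borel (Y 1)"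
    using assms(2,3) by (auto simp: iid_with_cdf_def indep_vars_def)
  then have PQ: "real_distribution P" "real_distribution Q" by (simp_all add: P_def Q_def)
  have F: "F\<^sub>X = cdf P" "F\<^sub>Y = cdf Q"
    using assms(2,3) by (auto simp: iid_with_cdf_def rv_cdf_def P_def Q_def)
  interpret P: real_distribution P by fact
  interpret Q: real_distribution Q by fact
  define G H where "G = (\<lambda>n x. record_phi n k (F\<^sub>X x))" and "H = (\<lambda>n x. record_phi n k (F\<^sub>Y x))"
  have G: "real_distribution (interval_measure (G n))" "cdf (interval_measure (G n)) = G n" for n
    using real_distribution_record_phi[OF PQ(1) k] by (simp_all add: G_def F)
  have H: "real_distribution (interval_measure (H n))" "cdf (interval_measure (H n)) = H n" for n
    using real_distribution_record_phi[OF PQ(2) k] by (simp_all add: H_def F)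
  have le: "H n x \<le> G n x" if "d \<le> x" for n x
    unfolding G_def H_def using assms(5)[OF that]
    by (intro record_phi_mono) (simp_all add: F Q.cdf_nonneg P.cdf_bounded_prob)
  have Hd: "(\<lambda>n. H n d) \<longlonglongrightarrow> 0"
    unfolding H_def using assms(4) by (intro record_phi_tendsto_zero) (simp_all add: F Q.cdf_nonneg)
  have ast_n: "measure lebesgue {u \<in> {0<..<1}. quantile (G n) u > quantile (H n) u} \<le> H n d" for n
    using measure_quantile_greater_le[OF G(1)[of n] H(1)[of n], of d] by (simp add: G H le)
  have asp_n: "1 / 2 - H n d \<le> measure (interval_measure (G n) \<Otimes>\<^sub>M interval_measure (H n)) {(x, y). x \<le> y}" for n
    using prob_le_ge_half_minus[OF G(1)[of n] H(1)[of n], of d] by (simp add: G H le)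
  have ast: "ast_le_cdf G H"
    unfolding ast_le_cdf_def
    by (rule tendsto_sandwich[OF _ _ tendsto_const Hd]; intro always_eventually allI ast_n measure_nonneg)
  have asp: "asp_le_indep_cdf G H"
    unfolding asp_le_indep_cdf_def by (rule half_le_liminf[OF Hd]) (simp add: asp_n)
  have "ast_le M (record_rv k X) (record_rv k Y) \<and>
       (indep_seqs M X Y \<longrightarrow> asp_le M (record_rv k X) (record_rv k Y))"
    if cdfs: "has_record_cdfs M k X F\<^sub>X" "has_record_cdfs M k Y F\<^sub>Y"
  proof (intro conjI impI)
    have cdf_n: "rv_cdf M (record_rv k X n) = G n" "rv_cdf M (record_rv k Y n) = H n" if "n \<ge> 1" for n
      using cdfs that by (auto simp: has_record_cdfs_def G_def H_def)
    \<comment> \<open>The hypothesis on the cdfs says nothing about \<open>n = 0\<close>, which the limit ignores.\<close>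
    show "ast_le M (record_rv k X) (record_rv k Y)"
      unfolding ast_le_def ast_le_cdf_def
    proof (rule Lim_transform_eventually)
      show "(\<lambda>n. measure lebesgue {u \<in> {0<..<1}. quantile (G n) u > quantile (H n) u}) \<longlonglongrightarrow> 0"
        using ast by (simp add: ast_le_cdf_def)
    qed (use eventually_ge_at_top[of 1] in \<open>eventually_elim, simp add: cdf_n\<close>)
    assume indep: "indep_seqs M X Y"
    have "1 / 2 - H n d \<le> prob {\<omega> \<in> space M. record_rv k X n \<omega> \<le> record_rv k Y n \<omega>}" if n: "n \<ge> 1" for n
    proof -
      let ?R = "record_rv k X n" and ?S = "record_rv k Y n"
      have ind: "indep_var borel ?R borel ?S"
        unfolding record_rv_eq_comp using indep measurable_record_value measurable_record_value
        unfolding indep_seqs_def by (rule indep_var_compose)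
      then have rv[measurable]: "random_variable borel ?R" "random_variable borel ?S"
        by (auto dest: indep_var_rv1 indep_var_rv2)
      \<comment> \<open>A law is determined by its cdf, so the joint law is the product treated above.\<close>
      have "distr M borel ?R = interval_measure (G n)" "distr M borel ?S = interval_measure (H n)"
        using cdf_n[OF n] rv by (auto intro!: cdf_unique G H simp: rv_cdf_def G H)
      then have "interval_measure (G n) \<Otimes>\<^sub>M interval_measure (H n) =
          distr M (borel \<Otimes>\<^sub>M borel) (\<lambda>\<omega>. (?R \<omega>, ?S \<omega>))"
        using ind by (simp add: indep_var_distribution_eq)
      then have "measure (interval_measure (G n) \<Otimes>\<^sub>M interval_measure (H n)) {(x, y). x \<le> y} =
          prob {\<omega> \<in> space M. ?R \<omega> \<le> ?S \<omega>}"
        using measurable_le_set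
        by (simp add: measure_distr vimage_def Int_def conj_commute)
      with asp_n[of n] show ?thesis by simp
    qed
    then show "asp_le M (record_rv k X) (record_rv k Y)"
      unfolding asp_le_def
      by (intro half_le_liminf[OF Hd] eventually_mono[OF eventually_ge_at_top[of 1]])
  qed
  with ast asp show "ast_le_cdf (\<lambda>n x. record_phi n k (F\<^sub>X x)) (\<lambda>n x. record_phi n k (F\<^sub>Y x)) \<and>
    asp_le_indep_cdf (\<lambda>n x. record_phi n k (F\<^sub>X x)) (\<lambda>n x. record_phi n k (F\<^sub>Y x)) \<and>
    (has_record_cdfs M k X F\<^sub>X \<and> has_record_cdfs M k Y F\<^sub>Y \<longrightarrow>
       ast_le M (record_rv k X) (record_rv k Y) \<and>
       (indep_seqs M X Y \<longrightarrow> asp_le M (record_rv k X) (record_rv k Y)))"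
    by (simp add: G_def H_def)
qed

end
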